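(* Let $d\geq 3$, $r>0$, and let $P,Q$ be two convex polytopes contained in the interior of the ball $r\mathbf{B}^{d}$. Assume that for every point $z$ on the sphere $rS^{d-1}=\partial(r\mathbf{B}^d)$ the support cones $C(z,P)$ and $C(z,Q)$ are congruent. Then $P=Q$.
   Context: $\mathbb{E}^d$ denotes $d$-dimensional Euclidean space with norm $|\cdot|$, $r\mathbf{B}^d=\{x\in\mathbb{E}^d: |x|\le r\}$, and $rS^{d-1}=\{x\in\mathbb{E}^d: |x|=r\}$. A convex polytope $P\subset\mathbb{E}^d$ is a convex body (compact convex set with non-empty interior) that is the convex hull of finitely many points. For a body $K$ and a point $z\notin K$, the support (sight) cone of $K$ from $z$ is $$C(z,K)=\bigcup_{x\in K}\{z+s(x-z): s\ge 0\}.$$ Two subsets $A,B\subset\mathbb{E}^d$ are congruent if there exist an orthogonal transformation $\varphi\in O(d)$ and a vector $b\in\mathbb{E}^d$ such that $\varphi(A)+b=B$. The congruence is allowed to depend on $z$. *)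

theory Defs
  imports "HOL-Analysis.Analysis"
begin

definition support_cone :: "'a::real_vector \<Rightarrow> 'a set \<Rightarrow> 'a set" where
  "support_cone z K = (\<Union>x\<in>K. {z + s *\<^sub>R (x - z) |s. s \<ge> 0})"

text \<open>Congruence is by arbitrary isometries, orientation-reversing ones included.\<close>

definition congruent_sets :: "'a::real_inner set \<Rightarrow> 'a set \<Rightarrow> bool" where
  "congruent_sets A B \<longleftrightarrow>
     (\<exists>\<phi> b. orthogonal_transformation \<phi> \<and> (\<lambda>x. \<phi> x + b) ` A = B)"

text \<open>The library's \<^const>\<open>polytope\<close> also admits lower-dimensional and empty hulls.\<close>

definition convex_polytope :: "'a::euclidean_space set \<Rightarrow> bool" where
  "convex_polytope P \<longleftrightarrow> polytope P \<and> interior P \<noteq> {}"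

end

theory Submission
  imports Defs "HOL-Computational_Algebra.Fundamental_Theorem_Algebra"
begin

text \<open>
  A vertex v of P spans an exposed ray of the cone at z for all z in an open part of the sphere, and
  each cone has a second exposed ray, through some vertex v'. The congruence carries both to
  rays through vertices w, w' of Q with the same angle between them. On the sphere the functions
  A(x,y) = (x - z) \<bullet> (y - z) and L(x) = A(x,x) are affine in z, so equality of the
  squared cosines reads A(v,v')^2 L(w) L(w') = A(w,w')^2 L(v) L(v'). Along a great circle, rationally
  parametrised, each factor becomes a real quadratic; by pigeonhole the identity holds for infinitely
  many parameters with fixed v', w, w', hence identically. As L(v) > 0 on the sphere, L(v) has no
  real root and is prime, so it divides A(v,v'), L(w) or L(w'). For a generic great circle this makes
  the two affine functions proportional, and since all vertices lie inside the ball this forces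
  v' = v, w = v or w' = v. Hence v is a vertex of Q.
\<close>

section \<open>Exposed rays of support cones\<close>

text \<open>The zero set of a supporting functional is a nonempty compact face, hence has an extreme
  point, and extreme points of a face are extreme in \<open>K\<close>. This turns an arbitrary point
  on a ray into a vertex.\<close>

lemma extreme_point_in_zero_face:
  fixes K :: "'a::euclidean_space set"
  assumes "compact K" "convex K" "x \<in> K" "a \<bullet> (x - z) = 0" "\<And>y. y \<in> K \<Longrightarrow> 0 \<le> a \<bullet> (y - z)"
  obtains w where "w extreme_point_of K" "a \<bullet> (w - z) = 0"
proof -
  define F where "F = K \<inter> {y. a \<bullet> y = a \<bullet> z}"
  have face: "F face_of K"
    unfolding F_def
    by (rule face_of_Int_supporting_hyperplane_ge) (use assms in \<open>auto simp: inner_diff_right\<close>)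
  moreover have "x \<in> F"
    using assms by (auto simp: F_def inner_diff_right)
  moreover have "compact F"
    using assms(1) by (simp add: F_def compact_Int_closed closed_hyperplane)
  moreover have "convex F"
    using assms(2) by (simp add: F_def convex_Int convex_hyperplane)
  ultimately obtain w where w: "w extreme_point_of F"
    using extreme_point_exists_convex by blast
  have "w extreme_point_of K"
    using extreme_point_of_face[OF face] w by blast
  moreover have "a \<bullet> (w - z) = 0"
    using w by (auto simp: F_def extreme_point_of_def inner_diff_right)
  ultimately show thesis by (rule that)
qed

text \<open>The ray is recorded by any point \<open>x\<close> of \<open>K\<close> on it. A
  hyperplane through \<open>z\<close> with normal \<open>a\<close> supports \<open>K\<close> and
  meets it only along this ray.\<close>

definition exposed_ray :: "'a::euclidean_space \<Rightarrow> 'a set \<Rightarrow> 'a \<Rightarrow> bool" where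
  "exposed_ray z K x \<longleftrightarrow> x \<in> K \<and> (\<exists>a. a \<bullet> (x - z) = 0 \<and>
     (\<forall>y\<in>K. 0 \<le> a \<bullet> (y - z) \<and> (a \<bullet> (y - z) = 0 \<longrightarrow> (\<exists>t\<ge>0. y - z = t *\<^sub>R (x - z)))))"

text \<open>The support cone moved to apex 0, where linear maps can act on it.\<close>

definition sight_directions :: "'a::euclidean_space \<Rightarrow> 'a set \<Rightarrow> 'a set" where
  "sight_directions z K = {s *\<^sub>R (x - z) |s x. s \<ge> 0 \<and> x \<in> K}"

lemma support_cone_eq: "support_cone z K = (+) z ` sight_directions z K"
  unfolding support_cone_def sight_directions_def by blast

text \<open>An isometry carries the supporting functional \<open>a\<close> to
  \<open>\<psi> a\<close>. The face of \<open>L\<close> on which that vanishes contains an extreme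
  point, and pulling it back lands on the exposed ray of \<open>x\<close>. With \<open>K = L\<close>
  and the identity, this also puts an extreme point on every exposed ray.\<close>

lemma exposed_ray_transfer:
  fixes K L :: "'a::euclidean_space set"
  assumes ex: "exposed_ray z K x" and z: "z \<notin> K" "z \<notin> L" and L: "compact L" "convex L"
    and orth: "orthogonal_transformation \<psi>"
    and im: "\<psi> ` sight_directions z K = sight_directions z L"
  obtains w s where "w extreme_point_of L" "s > 0" "\<psi> (x - z) = s *\<^sub>R (w - z)"
proof -
  obtain a where x: "x \<in> K" and a0: "a \<bullet> (x - z) = 0"
    and a: "\<And>y. y \<in> K \<Longrightarrow> 0 \<le> a \<bullet> (y - z)"
    and aeq: "\<And>y. y \<in> K \<Longrightarrow> a \<bullet> (y - z) = 0 \<Longrightarrow> \<exists>t\<ge>0. y - z = t *\<^sub>R (x - z)"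
    using ex unfolding exposed_ray_def by blast
  have lin: "linear \<psi>" and inner: "\<And>u v. \<psi> u \<bullet> \<psi> v = u \<bullet> v"
    using orth by (auto simp: orthogonal_transformation_def)
  \<comment> \<open>Each point of \<open>L\<close> is seen in the image direction of some point of
    \<open>K\<close>; the factor is nonzero because \<open>z\<close> is outside
    \<open>L\<close>.\<close>
  have pre: "\<exists>s p. s > 0 \<and> p \<in> K \<and> y - z = s *\<^sub>R \<psi> (p - z)" if "y \<in> L" for y
  proof -
    have "1 *\<^sub>R (y - z) \<in> sight_directions z L"
      unfolding sight_directions_def using that zero_le_one by blast
    then have "y - z \<in> \<psi> ` sight_directions z K" by (simp add: im)
    then obtain s p where sp: "s \<ge> 0" "p \<in> K" "y - z = \<psi> (s *\<^sub>R (p - z))"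
      unfolding sight_directions_def by auto
    moreover have "s \<noteq> 0"
      using sp that z linear_0[OF lin] by auto
    ultimately show ?thesis
      using linear_scale[OF lin] by (intro exI[of _ s] exI[of _ p]) auto
  qed
  have "1 *\<^sub>R (x - z) \<in> sight_directions z K"
    unfolding sight_directions_def using x zero_le_one by blast
  then have "\<psi> (x - z) \<in> sight_directions z L"
    using im by auto
  then obtain s q where sq: "s \<ge> 0" "q \<in> L" "\<psi> (x - z) = s *\<^sub>R (q - z)"
    unfolding sight_directions_def by auto
  have "x \<noteq> z" using x z by auto
  then have "\<psi> (x - z) \<noteq> 0"
    using inner[of "x - z" "x - z"] by auto
  then have "s > 0" using sq by (cases "s = 0") auto
  have "\<psi> a \<bullet> (q - z) = 0"
  proof -
    have "s * (\<psi> a \<bullet> (q - z)) = 0"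
      using sq(3) inner[of a "x - z"] a0 by simp
    with \<open>s > 0\<close> show ?thesis by simp
  qed
  moreover have "0 \<le> \<psi> a \<bullet> (y - z)" if "y \<in> L" for y
    using pre[OF that] a inner by fastforce
  ultimately obtain w where w: "w extreme_point_of L" "\<psi> a \<bullet> (w - z) = 0"
    using extreme_point_in_zero_face[OF L sq(2)] by blast
  have wL: "w \<in> L" using w by (simp add: extreme_point_of_def)
  obtain s' p where s': "s' > 0" "p \<in> K" "w - z = s' *\<^sub>R \<psi> (p - z)"
    using pre[OF wL] by blast
  with w inner have "a \<bullet> (p - z) = 0" by simp
  then obtain t where t: "t \<ge> 0" "p - z = t *\<^sub>R (x - z)"
    using aeq s' by blast
  have wz: "w - z = (s' * t) *\<^sub>R \<psi> (x - z)"
    using s' t linear_scale[OF lin] by simp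
  have "w \<noteq> z" using wL z by auto
  then have "t \<noteq> 0" using wz by auto
  then have pos: "s' * t > 0" using s' t by simp
  show thesis
    by (rule that[OF w(1), of "1 / (s' * t)"]) (use pos wz in auto)
qed

text \<open>In the cross-section of the cone by a hyperplane, the point farthest from the trace of
  \<open>v\<close> is exposed, and it differs from that trace because the section is not a single
  point.\<close>

lemma exposed_ray_obtains_other:
  fixes K :: "'a::euclidean_space set"
  assumes "compact K" "convex K" "interior K \<noteq> {}" "z \<notin> K" "v \<in> K" "DIM('a) \<ge> 2"
  obtains x where "exposed_ray z K x" "\<And>s. x - z \<noteq> s *\<^sub>R (v - z)"
proof -
  obtain a b where ab: "a \<bullet> z < b" "\<And>y. y \<in> K \<Longrightarrow> b < a \<bullet> y"
    using separating_hyperplane_closed_point assms compact_imp_closed by metis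
  have pos: "a \<bullet> (y - z) > 0" if "y \<in> K" for y
    using ab(1) ab(2)[OF that] by (simp add: inner_diff_right)
  \<comment> \<open>Central projection from \<open>z\<close>, in coordinates centred at
    \<open>z\<close>, onto the hyperplane where \<open>a\<close> takes the value 1.\<close>
  define p where "p y = (1 / (a \<bullet> (y - z))) *\<^sub>R (y - z)" for y
  have scale: "p y = p y'" if "y - z = s *\<^sub>R (y' - z)" "y \<in> K" for s y y'
    using pos[OF that(2)] that by (cases "s = 0") (simp_all add: p_def)
  have unscale: "y - z = (a \<bullet> (y - z)) *\<^sub>R p y" if "y \<in> K" for y
    using pos[OF that] by (simp add: p_def)
  have "continuous_on K (\<lambda>y. norm (p y - p v))"
    unfolding p_def using pos by (intro continuous_intros) force
  then obtain x where x: "x \<in> K" "\<And>y. y \<in> K \<Longrightarrow> norm (p y - p v) \<le> norm (p x - p v)"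
    using continuous_attains_sup[OF assms(1)] assms(5) by blast
  define e where "e = p x - p v"
  \<comment> \<open>Otherwise \<open>p\<close> is constant on \<open>K\<close>, so \<open>K\<close>
    lies on one line through \<open>z\<close>. A ball inside \<open>K\<close> contains two points
    whose nonzero difference is orthogonal to that line.\<close>
  have "e \<noteq> 0"
  proof
    assume "e = 0"
    then have eq: "p y = p v" if "y \<in> K" for y
      using x(2)[OF that] by (simp add: e_def)
    obtain y d where yd: "d > 0" "cball y d \<subseteq> K"
      using assms(3) mem_interior_cball by blast
    obtain u where u: "u \<noteq> 0" "orthogonal (p v) u"
      using orthogonal_to_vector_exists[OF assms(6)] by blast
    define y' where "y' = y + (d / norm u) *\<^sub>R u"
    have K: "y \<in> K" "y' \<in> K"
      using yd u by (auto simp: y'_def dist_norm subset_iff)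
    have "(d / norm u) *\<^sub>R u = (y' - z) - (y - z)" by (simp add: y'_def)
    also have "\<dots> = (a \<bullet> (y' - z) - a \<bullet> (y - z)) *\<^sub>R p v"
      using unscale K eq by (metis scaleR_left_diff_distrib)
    finally have "(d / norm u) * (u \<bullet> u) = 0"
      using u(2) by (metis inner_scaleR_left mult_zero_right orthogonal_def)
    then show False using u yd by simp
  qed
  \<comment> \<open>Homogenised form of the functional exposing \<open>p x\<close>: on the
    hyperplane where \<open>a\<close> is 1, it is \<open>e \<bullet> p x\<close> minus the inner
    product with \<open>e\<close>.\<close>
  define c where "c = (e \<bullet> p x) *\<^sub>R a - e"
  have c: "c \<bullet> (y - z) = (a \<bullet> (y - z)) * (e \<bullet> (p x - p y))" if "y \<in> K" for y
  proof -
    have "e \<bullet> (y - z) = e \<bullet> ((a \<bullet> (y - z)) *\<^sub>R p y)"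
      using unscale[OF that] by (rule arg_cong)
    then show ?thesis
      unfolding c_def inner_diff_left inner_diff_right[of e "p x"] by (simp add: right_diff_distrib)
  qed
  \<comment> \<open>The ball about \<open>p v\<close> through \<open>p x\<close> contains the
    section and meets its tangent hyperplane at \<open>p x\<close> only there.\<close>
  have key: "0 \<le> e \<bullet> (p x - p y)" "e \<bullet> (p x - p y) = 0 \<Longrightarrow> p y = p x" if "y \<in> K" for y
  proof -
    define f where "f = p y - p v"
    have le: "f \<bullet> f \<le> e \<bullet> e"
      using x(2)[OF that] by (simp add: e_def f_def norm_le)
    have sq: "0 \<le> (e - f) \<bullet> (e - f)" by simp
    have id: "2 * (e \<bullet> (e - f)) = (e \<bullet> e - f \<bullet> f) + (e - f) \<bullet> (e - f)"
      by (simp add: inner_diff_left inner_diff_right inner_commute)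
    have d: "p x - p y = e - f" by (simp add: e_def f_def)
    show "0 \<le> e \<bullet> (p x - p y)" using id le sq unfolding d by linarith
    show "p y = p x" if "e \<bullet> (p x - p y) = 0"
    proof -
      have "(e - f) \<bullet> (e - f) = 0" using that id le sq unfolding d by linarith
      then show ?thesis by (simp add: d[symmetric])
    qed
  qed
  have "exposed_ray z K x"
    unfolding exposed_ray_def
  proof (intro conjI exI[of _ c] ballI impI)
    show "x \<in> K" by (fact x)
    show "c \<bullet> (x - z) = 0" using c[OF x(1)] by simp
    fix y assume y: "y \<in> K"
    show "0 \<le> c \<bullet> (y - z)"
      using c[OF y] pos[OF y] key(1)[OF y] by simp
    assume "c \<bullet> (y - z) = 0"
    then have "p y = p x"
      using c[OF y] pos[OF y] key(2)[OF y] by simp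
    then have "y - z = (a \<bullet> (y - z) / (a \<bullet> (x - z))) *\<^sub>R (x - z)"
      using unscale[OF y] by (simp add: p_def)
    then show "\<exists>t\<ge>0. y - z = t *\<^sub>R (x - z)"
      using pos[OF y] pos[OF x(1)] by (intro exI[of _ "a \<bullet> (y - z) / (a \<bullet> (x - z))"]) simp
  qed
  moreover have "x - z \<noteq> s *\<^sub>R (v - z)" for s
    using scale[OF _ x(1)] \<open>e \<noteq> 0\<close> by (auto simp: e_def)
  ultimately show thesis by (rule that)
qed

text \<open>A congruence must match the apexes because the cone of \<open>L\<close> is pointed; what
  remains is its linear part.\<close>

lemma congruent_support_cones_directions:
  fixes K L :: "'a::euclidean_space set"
  assumes "congruent_sets (support_cone z K) (support_cone z L)"
    and "K \<noteq> {}" "L \<noteq> {}" "closed L" "convex L" "z \<notin> L"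
  obtains \<psi> where "orthogonal_transformation \<psi>" "\<psi> ` sight_directions z K = sight_directions z L"
proof -
  obtain \<psi> b where \<psi>: "orthogonal_transformation \<psi>"
    and im: "(\<lambda>x. \<psi> x + b) ` support_cone z K = support_cone z L"
    using assms(1) unfolding congruent_sets_def by blast
  have lin: "linear \<psi>" using \<psi> by (simp add: orthogonal_transformation_def)
  \<comment> \<open>The translation part after both apexes are moved to 0.\<close>
  define c where "c = \<psi> z + b - z"
  have im': "(\<lambda>x. \<psi> x + c) ` sight_directions z K = sight_directions z L"
  proof -
    have "(+) z ` ((\<lambda>x. \<psi> x + c) ` sight_directions z K) = (\<lambda>x. \<psi> x + b) ` support_cone z K"
      by (simp add: support_cone_eq image_image c_def linear_add[OF lin] add_ac)
    then show ?thesis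
      unfolding im support_cone_eq[of z L] by (simp add: inj_image_eq_iff)
  qed
  have zero: "0 \<in> sight_directions z K" "0 \<in> sight_directions z L"
    using assms(2,3) unfolding sight_directions_def by fastforce+
  have "c \<in> sight_directions z L"
    using im' zero(1) linear_0[OF lin] by force
  \<comment> \<open>\<open>u\<close> is sent to 0 by the affine map. Doubling \<open>u\<close> stays
    in the cone and is sent to \<open>- c\<close>, so both \<open>c\<close> and \<open>- c\<close>
    lie in the pointed cone of \<open>L\<close>.\<close>
  obtain u where u: "u \<in> sight_directions z K" "\<psi> u = - c"
    using im' zero(2) by (force simp: eq_neg_iff_add_eq_0)
  then have "2 *\<^sub>R u \<in> sight_directions z K"
    unfolding sight_directions_def
    by clarsimp (metis mult_nonneg_nonneg zero_le_numeral)
  then have "\<psi> (2 *\<^sub>R u) + c \<in> sight_directions z L"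
    using im' by blast
  then have "- c \<in> sight_directions z L"
    using u by (simp add: linear_add[OF lin] scaleR_2)
  obtain a h where ah: "a \<bullet> z < h" "\<And>y. y \<in> L \<Longrightarrow> h < a \<bullet> y"
    using separating_hyperplane_closed_point assms by metis
  have pos: "a \<bullet> (y - z) > 0" if "y \<in> L" for y
    using ah(1) ah(2)[OF that] by (simp add: inner_diff_right)
  have nonneg: "a \<bullet> d \<ge> 0" if "d \<in> sight_directions z L" for d
    using that pos by (auto simp: sight_directions_def less_imp_le)
  have "a \<bullet> c = 0"
    using nonneg[OF \<open>c \<in> _\<close>] nonneg[OF \<open>- c \<in> _\<close>] by simp
  then have "c = 0"
    using \<open>c \<in> _\<close> pos by (force simp: sight_directions_def)
  then show thesis
    using that \<psi> im' by simp
qed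

text \<open>Tilting a supporting hyperplane at a vertex v about v makes it pass through any
  nearby point z, so v spans an exposed ray for all z in a relatively open set.\<close>

lemma vertex_exposed_ray_near:
  fixes P :: "'a::euclidean_space set"
  assumes P: "polytope P" "v extreme_point_of P" and "norm v < r" "DIM('a) \<ge> 2"
  obtains z0 W where "norm z0 = r" "open W" "z0 \<in> W" "\<And>z. z \<in> W \<Longrightarrow> exposed_ray z P v"
proof -
  have vP: "v \<in> P" using P by (simp add: extreme_point_of_def)
  define V' where "V' = {x. x extreme_point_of P} - {v}"
  define P' where "P' = convex hull V'"
  have cP: "compact P" "convex P" using P by (auto simp: polytope_imp_compact polytope_imp_convex)
  have fin: "finite V'"
    using finite_polyhedron_extreme_points[OF polytope_imp_polyhedron[OF P(1)]]
    by (simp add: V'_def)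
  have P'P: "P' \<subseteq> P"
    unfolding P'_def using cP by (intro hull_minimal) (auto simp: V'_def extreme_point_of_def)
  \<comment> \<open>\<open>v\<close> would remain extreme in the smaller set \<open>P'\<close>,
    whereas extreme points of a hull belong to the generating set \<open>V'\<close>.\<close>
  have vnot: "v \<notin> P'"
  proof
    assume "v \<in> P'"
    then have "v extreme_point_of P'"
      using P(2) P'P by (auto simp: extreme_point_of_def)
    then show False
      using extreme_point_of_convex_hull by (fastforce simp: P'_def V'_def)
  qed
  have cP': "compact P'" "convex P'" "closed P'"
    using fin by (simp_all add: P'_def finite_imp_compact_convex_hull compact_imp_closed)
  obtain a h where ah: "a \<bullet> v < h" "\<And>y. y \<in> P' \<Longrightarrow> h < a \<bullet> y"
    using separating_hyperplane_closed_point[OF cP'(2,3) vnot] by blast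
  define \<delta> where "\<delta> = h - a \<bullet> v"
  have \<delta>: "\<delta> > 0" "\<And>y. y \<in> P' \<Longrightarrow> \<delta> < a \<bullet> (y - v)"
    using ah by (auto simp: \<delta>_def inner_diff_right)
  obtain R where R: "R > 0" "\<And>y. y \<in> P' \<Longrightarrow> norm (y - v) \<le> R"
  proof -
    have "bounded ((\<lambda>y. y - v) ` P')"
      using cP' compact_imp_bounded bounded_translation_minus by blast
    then show thesis using that unfolding bounded_pos by auto
  qed
  obtain e0 where e0: "e0 \<noteq> 0" "orthogonal a e0"
    using orthogonal_to_vector_exists[OF assms(4)] by blast
  \<comment> \<open>From \<open>v\<close>, move inside the hyperplane orthogonal to \<open>a\<close>
    until the sphere is reached; \<open>b\<close> below is long enough for the intermediate value
    theorem.\<close>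
  obtain z0 where z0: "norm z0 = r" "a \<bullet> (v - z0) = 0"
  proof -
    obtain d where d: "norm (v + d *\<^sub>R e0) = r"
    proof -
      define b where "b = (r + norm v) / norm e0"
      have "b \<ge> 0" using assms(3) norm_ge_zero[of v] unfolding b_def
          by (intro divide_nonneg_nonneg add_nonneg_nonneg norm_ge_zero) linarith
      have "norm (b *\<^sub>R e0) = r + norm v"
        using \<open>b \<ge> 0\<close> e0 assms(3) norm_ge_zero[of v] by (simp add: b_def del: norm_ge_zero)
      then have "r \<le> norm (v + b *\<^sub>R e0)"
        using norm_triangle_ineq4[of "v + b *\<^sub>R e0" v] by simp
      then have "\<exists>x\<ge>0. x \<le> b \<and> norm (v + x *\<^sub>R e0) = r"
        using assms(3) \<open>b \<ge> 0\<close> by (intro IVT') (auto intro!: continuous_intros)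
      then show thesis using that by blast
    qed
    show thesis
      by (rule that[OF d]) (use e0 in \<open>simp add: orthogonal_def\<close>)
  qed
  \<comment> \<open>The condition keeps the effect of the tilt on \<open>P'\<close> below the
    separation margin \<open>\<delta>\<close>; being strict, it also excludes
    \<open>z = v\<close>.\<close>
  define W where "W = {z. \<bar>a \<bullet> (v - z)\<bar> * R < \<delta> * norm (v - z)}"
  have "open W" unfolding W_def by (intro open_Collect_less continuous_intros)
  moreover have "z0 \<in> W"
  proof -
    have "v \<noteq> z0" using z0(1) assms(3) by auto
    then show ?thesis using z0(2) \<delta>(1) by (simp add: W_def)
  qed
  moreover have "exposed_ray z P v" if "z \<in> W" for z
  proof -
    define n where "n = norm (v - z)"
    have "v \<noteq> z" using that by (auto simp: W_def)
    then have n: "n > 0" by (simp add: n_def)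
    \<comment> \<open>\<open>a\<close> without its component along \<open>v - z\<close>, so the
      tilted hyperplane contains both \<open>v\<close> and \<open>z\<close>.\<close>
    define a' where "a' = a - (a \<bullet> (v - z) / n\<^sup>2) *\<^sub>R (v - z)"
    have orth: "a' \<bullet> (v - z) = 0"
      using n by (simp add: a'_def inner_diff_left n_def dot_square_norm)
    have pos: "a' \<bullet> (y - v) > 0" if "y \<in> P'" for y
    proof -
      have "(a \<bullet> (v - z) / n\<^sup>2) * ((v - z) \<bullet> (y - v)) \<le> \<bar>a \<bullet> (v - z)\<bar> / n\<^sup>2 * (n * R)"
      proof -
        have "\<bar>(v - z) \<bullet> (y - v)\<bar> \<le> n * R"
          using Cauchy_Schwarz_ineq2[of "v - z" "y - v"] R(2)[OF that] n
          by (metis mult_left_mono n_def norm_ge_zero order_trans)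
        then have "\<bar>a \<bullet> (v - z) / n\<^sup>2\<bar> * \<bar>(v - z) \<bullet> (y - v)\<bar> \<le> \<bar>a \<bullet> (v - z) / n\<^sup>2\<bar> * (n * R)"
          by (intro mult_left_mono) auto
        then have "\<bar>(a \<bullet> (v - z) / n\<^sup>2) * ((v - z) \<bullet> (y - v))\<bar> \<le> \<bar>a \<bullet> (v - z)\<bar> / n\<^sup>2 * (n * R)"
          by (simp only: abs_mult abs_divide abs_power2)
        then show ?thesis by (rule abs_le_D1)
      qed
      also have "\<dots> = \<bar>a \<bullet> (v - z)\<bar> * R / n" using n by (simp add: power2_eq_square)
      also have "\<dots> < \<delta>" using \<open>z \<in> W\<close> n by (simp add: W_def n_def field_simps)
      finally show ?thesis
        using \<delta>(2)[OF that] by (simp add: a'_def inner_diff_left)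
    qed
    have hull: "P = convex hull (insert v V')"
      using Krein_Milman_Minkowski[OF cP] P(2) by (simp add: V'_def insert_absorb)
    have all: "0 \<le> a' \<bullet> (y - v) \<and> (a' \<bullet> (y - v) = 0 \<longrightarrow> y = v)" if "y \<in> P" for y
    proof (cases "V' = {}")
      case True
      then show ?thesis using that hull by simp
    next
      case False
      have "y \<in> convex hull (insert v V')" using that by (subst hull[symmetric])
      then obtain s t y' where st: "0 \<le> s" "0 \<le> t" "s + t = 1" "y' \<in> P'" "y = s *\<^sub>R v + t *\<^sub>R y'"
        unfolding P'_def convex_hull_insert[OF False] by blast
      have "s = 1 - t" using st(3) by simp
      then have y: "y - v = t *\<^sub>R (y' - v)"
        unfolding st(5) by (simp only: scaleR_left_diff_distrib scaleR_right_diff_distrib) simp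
      then show ?thesis using pos[OF st(4)] st by (cases "t = 0") auto
    qed
    have shift: "a' \<bullet> (y - z) = a' \<bullet> (y - v)" for y
      using orth by (simp add: inner_diff_right)
    show ?thesis
      unfolding exposed_ray_def
    proof (intro conjI exI[of _ a'] ballI impI vP orth)
      fix y assume y: "y \<in> P"
      show "0 \<le> a' \<bullet> (y - z)" using all[OF y] shift by simp
      assume "a' \<bullet> (y - z) = 0"
      then have "y = v" using all[OF y] shift by simp
      then show "\<exists>t\<ge>0. y - z = t *\<^sub>R (v - z)" by (intro exI[of _ 1]) simp
    qed
  qed
  ultimately show thesis using that[OF z0(1), of W] by blast
qed

section \<open>Affine functions on great circles\<close>

text \<open>The circle is parametrised rationally; the point opposite to u is missed.\<close>

definition circle_point :: "'a::real_inner \<Rightarrow> 'a \<Rightarrow> real \<Rightarrow> 'a" where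
  "circle_point u e t = (1 / (1 + t\<^sup>2)) *\<^sub>R ((1 - t\<^sup>2) *\<^sub>R u + (2 * t) *\<^sub>R e)"

text \<open>Numerator of the affine function \<open>\<alpha> + \<beta> \<bullet> z\<close> along the
  circle, after multiplying by \<open>1 + t\<^sup>2\<close>. Complex coefficients make nonreal roots
  available.\<close>

definition circle_poly :: "'a::real_inner \<Rightarrow> 'a \<Rightarrow> real \<Rightarrow> 'a \<Rightarrow> complex poly" where
  "circle_poly u e \<alpha> \<beta> = [: of_real (\<alpha> + \<beta> \<bullet> u), of_real (2 * (\<beta> \<bullet> e)), of_real (\<alpha> - \<beta> \<bullet> u) :]"

lemma one_plus_square_pos: "1 + t\<^sup>2 > (0::real)"
  by (simp add: add_pos_nonneg)

lemma poly_circle_poly: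
  "poly (circle_poly u e \<alpha> \<beta>) (of_real t) = of_real ((1 + t\<^sup>2) * (\<alpha> + \<beta> \<bullet> circle_point u e t))"
proof -
  have "(1 + t\<^sup>2) * (\<alpha> + \<beta> \<bullet> circle_point u e t)
      = (1 + t\<^sup>2) * \<alpha> + ((1 - t\<^sup>2) * (\<beta> \<bullet> u) + (2 * t) * (\<beta> \<bullet> e))"
    using one_plus_square_pos[of t]
    by (simp add: circle_point_def inner_add_right distrib_left)
  also have "\<dots> = (\<alpha> + \<beta> \<bullet> u) + t * (2 * (\<beta> \<bullet> e) + t * (\<alpha> - \<beta> \<bullet> u))"
    by (simp add: algebra_simps power2_eq_square)
  finally show ?thesis
    by (simp add: circle_poly_def)
qed

lemma norm_circle_point:
  assumes "norm u = r" "norm e = r" "u \<bullet> e = 0"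
  shows "norm (circle_point u e t) = r"
proof -
  have r: "r \<ge> 0" "u \<bullet> u = r\<^sup>2" "e \<bullet> e = r\<^sup>2" "e \<bullet> u = 0"
    using assms by (auto simp: dot_square_norm inner_commute)
  let ?y = "(1 - t\<^sup>2) *\<^sub>R u + (2 * t) *\<^sub>R e"
  have "(norm ?y)\<^sup>2 = (1 - t\<^sup>2)\<^sup>2 * (u \<bullet> u) + (2 * t)\<^sup>2 * (e \<bullet> e)"
    unfolding power2_norm_eq_inner inner_add_left inner_add_right inner_scaleR_left inner_scaleR_right
      r(4) assms(3) by (simp only: power2_eq_square mult_zero_right add_0_left add_0_right mult.assoc)
  also have "\<dots> = (1 - t\<^sup>2)\<^sup>2 * r\<^sup>2 + (2 * t)\<^sup>2 * r\<^sup>2" by (simp only: r)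
  also have "\<dots> = ((1 + t\<^sup>2) * r)\<^sup>2"
    by (simp add: power2_eq_square algebra_simps)
  finally have "norm ?y = (1 + t\<^sup>2) * r"
    using r one_plus_square_pos[of t] by (simp add: power2_eq_iff_nonneg)
  then show ?thesis
    using one_plus_square_pos[of t] by (simp add: circle_point_def)
qed

text \<open>Eliminating the square of \<open>\<tau>\<close> leaves a linear relation with real
  coefficients, which a nonreal number satisfies only trivially.\<close>

lemma nonreal_common_root:
  fixes a0 a1 a2 b0 b1 b2 :: real and \<tau> :: complex
  assumes "Im \<tau> \<noteq> 0"
    and "poly [:of_real a0, of_real a1, of_real a2:] \<tau> = 0"
    and "poly [:of_real b0, of_real b1, of_real b2:] \<tau> = 0"
  shows "a2 * b1 = b2 * a1" "a2 * b0 = b2 * a0"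
proof -
  let ?p = "of_real a0 + \<tau> * (of_real a1 + \<tau> * of_real a2)"
  let ?q = "of_real b0 + \<tau> * (of_real b1 + \<tau> * of_real b2)"
  have "of_real (a2 * b1 - b2 * a1) * \<tau> + of_real (a2 * b0 - b2 * a0)
      = of_real a2 * ?q - of_real b2 * ?p"
    by (simp add: algebra_simps)
  also have "\<dots> = 0" using assms(2,3) by simp
  finally have *: "of_real (a2 * b1 - b2 * a1) * \<tau> + of_real (a2 * b0 - b2 * a0) = 0" .
  then have "Im (of_real (a2 * b1 - b2 * a1) * \<tau> + of_real (a2 * b0 - b2 * a0)) = 0"
    by simp
  then have "(a2 * b1 - b2 * a1) * Im \<tau> = 0" by simp
  then have **: "a2 * b1 - b2 * a1 = 0" using assms(1) by simp
  then show "a2 * b1 = b2 * a1" by simp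
  show "a2 * b0 = b2 * a0"
    using * ** by (metis eq_iff_diff_eq_0 add_0 mult_zero_left of_real_0 of_real_eq_0_iff)
qed

text \<open>The leading coefficient is the value of the affine function at \<open>- u\<close>, hence
  positive, so a root exists. A real root would be a zero on the sphere.\<close>

lemma circle_poly_positive_root:
  assumes "norm u = r" "norm e = r" "u \<bullet> e = 0"
    and pos: "\<And>z. norm z = r \<Longrightarrow> 0 < \<alpha> + \<beta> \<bullet> z"
  obtains \<tau> where "poly (circle_poly u e \<alpha> \<beta>) \<tau> = 0" "Im \<tau> \<noteq> 0"
proof -
  have "\<alpha> - \<beta> \<bullet> u > 0" using pos[of "- u"] assms(1) by simp
  then have "\<not> constant (poly (circle_poly u e \<alpha> \<beta>))"
    by (simp add: constant_degree circle_poly_def)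
  then obtain \<tau> where \<tau>: "poly (circle_poly u e \<alpha> \<beta>) \<tau> = 0"
    using fundamental_theorem_of_algebra by blast
  moreover have "Im \<tau> \<noteq> 0"
  proof
    assume "Im \<tau> = 0"
    then have "\<tau> = of_real (Re \<tau>)" by (simp add: complex_eq_iff)
    then have "(1 + (Re \<tau>)\<^sup>2) * (\<alpha> + \<beta> \<bullet> circle_point u e (Re \<tau>)) = 0"
      using \<tau> poly_circle_poly by (metis of_real_eq_0_iff)
    then show False
      using pos[OF norm_circle_point[OF assms(1-3)]] one_plus_square_pos[of "Re \<tau>"]
      by (metis less_irrefl mult_eq_0_iff)
  qed
  ultimately show thesis by (rule that)
qed

text \<open>Two real quadratics sharing a nonreal root are proportional. On a generic great circle
  through u this lifts from the circle to the whole space.\<close>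

lemma generic_great_circle:
  fixes u :: "'a::euclidean_space" and \<beta>0 :: 'a and G :: "(real \<times> 'a) set"
  assumes "finite G" "norm u = r" "r > 0" "DIM('a) \<ge> 2"
    and pos: "\<And>z. norm z = r \<Longrightarrow> 0 < \<alpha>0 + \<beta>0 \<bullet> z"
  obtains e where "norm e = r" "u \<bullet> e = 0"
    "\<And>\<alpha> \<beta> \<tau>. (\<alpha>, \<beta>) \<in> G \<Longrightarrow> poly (circle_poly u e \<alpha>0 \<beta>0) \<tau> = 0 \<Longrightarrow> Im \<tau> \<noteq> 0 \<Longrightarrow>
       poly (circle_poly u e \<alpha> \<beta>) \<tau> = 0 \<Longrightarrow> \<exists>l. \<alpha> = l * \<alpha>0 \<and> \<beta> = l *\<^sub>R \<beta>0"
proof -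
  define f0 where "f0 = \<alpha>0 - \<beta>0 \<bullet> u"
  have f0: "f0 > 0" using pos[of "- u"] assms(2) by (simp add: f0_def)
  \<comment> \<open>Proportionality of the quadratics makes this vector orthogonal to
    \<open>e\<close>.\<close>
  define \<gamma> where "\<gamma> = (\<lambda>(\<alpha>, \<beta>). f0 *\<^sub>R \<beta> - (\<alpha> - \<beta> \<bullet> u) *\<^sub>R \<beta>0)"
  have uu: "u \<bullet> u = r\<^sup>2" "u \<bullet> u > 0" using assms(2,3) by (auto simp: dot_square_norm)
  define \<pi> where "\<pi> x = x - ((x \<bullet> u) / (u \<bullet> u)) *\<^sub>R u" for x :: 'a
  have \<pi>u: "u \<bullet> \<pi> x = 0" for x using uu by (simp add: \<pi>_def inner_diff_right inner_commute)
  have \<pi>sym: "\<pi> x \<bullet> y = x \<bullet> \<pi> y" for x y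
    by (simp add: \<pi>_def inner_diff_right inner_diff_left inner_commute)
  obtain q where q: "q \<noteq> 0" "orthogonal u q"
    using orthogonal_to_vector_exists[OF assms(4)] by blast
  \<comment> \<open>The chosen \<open>x\<close> avoids the hyperplanes orthogonal to these finitely
    many vectors, which have measure zero. The vector \<open>q\<close> ensures that
    \<open>\<pi> x\<close>, the projection orthogonal to \<open>u\<close>, is nonzero.\<close>
  define N where "N = insert q (\<pi> ` \<gamma> ` G) - {0}"
  have "finite N" using assms(1) by (simp add: N_def)
  have "negligible (\<Union>n\<in>N. {x. n \<bullet> x = 0})"
    using \<open>finite N\<close> by (intro negligible_Union) (auto simp: N_def intro!: negligible_hyperplane)
  then have "(\<Union>n\<in>N. {x. n \<bullet> x = 0}) \<noteq> UNIV"
    using non_negligible_UNIV by metis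
  then obtain x where x: "\<And>n. n \<in> N \<Longrightarrow> n \<bullet> x \<noteq> 0" by blast
  have "q \<bullet> \<pi> x = q \<bullet> x"
    using q by (simp add: \<pi>_def inner_diff_right orthogonal_def inner_commute)
  then have "\<pi> x \<noteq> 0" using x[of q] q by (auto simp: N_def)
  define k where "k = r / norm (\<pi> x)"
  define e where "e = k *\<^sub>R \<pi> x"
  have k: "k > 0" using \<open>\<pi> x \<noteq> 0\<close> assms(3) by (simp add: k_def)
  have e: "norm e = r" "u \<bullet> e = 0"
    using \<open>\<pi> x \<noteq> 0\<close> assms(3) \<pi>u by (simp_all add: e_def k_def)
  show thesis
  proof (rule that[OF e])
    fix \<alpha> \<beta> \<tau>
    assume G: "(\<alpha>, \<beta>) \<in> G" and \<tau>: "poly (circle_poly u e \<alpha>0 \<beta>0) \<tau> = 0" "Im \<tau> \<noteq> 0"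
      "poly (circle_poly u e \<alpha> \<beta>) \<tau> = 0"
    define l where "l = (\<alpha> - \<beta> \<bullet> u) / f0"
    have l: "\<alpha> - \<beta> \<bullet> u = l * f0" using f0 by (simp add: l_def)
    have "f0 * (2 * (\<beta> \<bullet> e)) = (\<alpha> - \<beta> \<bullet> u) * (2 * (\<beta>0 \<bullet> e))"
      and up: "f0 * (\<alpha> + \<beta> \<bullet> u) = (\<alpha> - \<beta> \<bullet> u) * (\<alpha>0 + \<beta>0 \<bullet> u)"
      using nonreal_common_root[OF \<tau>(2) \<tau>(1)[unfolded circle_poly_def] \<tau>(3)[unfolded circle_poly_def]]
      by (simp_all add: f0_def)
    then have "\<gamma> (\<alpha>, \<beta>) \<bullet> e = 0" by (simp add: \<gamma>_def inner_diff_left)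
    then have "\<pi> (\<gamma> (\<alpha>, \<beta>)) \<bullet> x = 0" using k by (simp add: e_def \<pi>sym)
    then have "\<pi> (\<gamma> (\<alpha>, \<beta>)) = 0"
      using x[of "\<pi> (\<gamma> (\<alpha>, \<beta>))"] G by (auto simp: N_def)
    \<comment> \<open>Genericity leaves only a component along \<open>u\<close>; the values at
      \<open>u\<close> and \<open>- u\<close> eliminate it below.\<close>
    then obtain m0 where "\<gamma> (\<alpha>, \<beta>) = m0 *\<^sub>R u" by (auto simp: \<pi>_def)
    then have "f0 *\<^sub>R (\<beta> - l *\<^sub>R \<beta>0) = m0 *\<^sub>R u"
      by (simp add: \<gamma>_def l scaleR_diff_right mult.commute)
    then have "\<beta> - l *\<^sub>R \<beta>0 = (m0 / f0) *\<^sub>R u"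
      using f0 by (metis divide_inverse_commute less_irrefl
          scaleR_scaleR scaleR_one left_inverse)
    then have bl: "\<beta> = l *\<^sub>R \<beta>0 + (m0 / f0) *\<^sub>R u" by (simp add: algebra_simps)
    define m where "m = m0 / f0"
    have "\<alpha> + \<beta> \<bullet> u = l * (\<alpha>0 + \<beta>0 \<bullet> u)"
      using up f0 unfolding l by simp
    moreover have "\<alpha> - \<beta> \<bullet> u = l * (\<alpha>0 - \<beta>0 \<bullet> u)" using l by (simp add: f0_def)
    moreover have "\<beta> \<bullet> u = l * (\<beta>0 \<bullet> u) + m * (u \<bullet> u)" by (simp add: bl m_def inner_add_left)
    ultimately have "m * (u \<bullet> u) = 0" "\<alpha> = l * \<alpha>0"
      by (simp_all add: algebra_simps)
    then show "\<exists>l. \<alpha> = l * \<alpha>0 \<and> \<beta> = l *\<^sub>R \<beta>0"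
      using uu bl by (auto simp: m_def)
  qed
qed

section \<open>Recovering the vertices\<close>

text \<open>The only quadratic term, \<open>z \<bullet> z\<close>, is constant on the
  sphere.\<close>

lemma inner_on_sphere:
  fixes v w z :: "'a::real_inner"
  assumes "norm z = r"
  shows "(v - z) \<bullet> (w - z) = (v \<bullet> w + r\<^sup>2) + (- (v + w)) \<bullet> z"
proof -
  have z: "z \<bullet> z = r\<^sup>2" using assms dot_square_norm[of z] by simp
  show ?thesis
    unfolding inner_diff_left inner_diff_right inner_minus_left inner_add_left inner_commute[of z w] z
    by simp
qed

lemma sq_dist_on_sphere:
  fixes v z :: "'a::real_inner"
  assumes "norm z = r"
  shows "(v - z) \<bullet> (v - z) = (v \<bullet> v + r\<^sup>2) + (- 2 *\<^sub>R v) \<bullet> z"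
  unfolding inner_on_sphere[OF assms] by (simp add: inner_diff_left)

text \<open>With \<open>w = l *\<^sub>R v\<close>, the constant terms give a factor
  \<open>l - 1\<close> and a second factor. The latter vanishes only if \<open>w\<close> is the
  inverse of \<open>v\<close> in the sphere, which lies outside the ball.\<close>

lemma sq_dist_proportional:
  fixes v w :: "'a::real_inner"
  assumes "norm v < r" "norm w < r"
    and "w \<bullet> w + r\<^sup>2 = l * (v \<bullet> v + r\<^sup>2)" "- 2 *\<^sub>R w = l *\<^sub>R (- 2 *\<^sub>R v)"
  shows "w = v"
proof -
  have "2 *\<^sub>R w = 2 *\<^sub>R (l *\<^sub>R v)" using assms(4) by (simp add: mult.commute)
  then have w: "w = l *\<^sub>R v" by (simp only: scaleR_cancel_left) simp
  have "(l - 1) * (l * (v \<bullet> v) - r\<^sup>2) = 0"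
    using assms(3) by (simp add: w algebra_simps power2_eq_square)
  moreover have "l * (v \<bullet> v) \<noteq> r\<^sup>2"
  proof
    assume eq: "l * (v \<bullet> v) = r\<^sup>2"
    have "v \<bullet> w < r * r"
    proof -
      have "v \<bullet> w \<le> norm v * norm w" by (rule norm_cauchy_schwarz)
      also have "\<dots> < r * r" using assms(1,2) by (intro mult_strict_mono') auto
      finally show ?thesis .
    qed
    then show False using eq by (simp add: w power2_eq_square)
  qed
  ultimately show ?thesis by (simp add: w)
qed

text \<open>Here \<open>w = (2 * l - 1) *\<^sub>R v\<close>, and the constant terms reduce to
  \<open>(l - 1) * (v \<bullet> v - r\<^sup>2) = 0\<close>.\<close>

lemma inner_proportional:
  fixes v w :: "'a::real_inner"
  assumes "norm v < r" "v \<bullet> w + r\<^sup>2 = l * (v \<bullet> v + r\<^sup>2)" "- (v + w) = l *\<^sub>R (- 2 *\<^sub>R v)"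
  shows "w = v"
proof -
  have "v + w = (2 * l) *\<^sub>R v"
    using assms(3) by (metis neg_equal_iff_equal scaleR_minus_left scaleR_scaleR mult.commute)
  then have w: "w = (2 * l - 1) *\<^sub>R v" by (simp add: algebra_simps)
  have v2: "v \<bullet> v < r\<^sup>2"
    using assms(1) by (simp add: dot_square_norm power_strict_mono)
  have "(l - 1) * (v \<bullet> v - r\<^sup>2) = 0"
    using assms(2) by (simp add: w algebra_simps)
  then show ?thesis using v2 by (simp add: w)
qed

text \<open>Half of the equality of vertex sets. If \<open>v\<close> is not a vertex of
  \<open>Q\<close>, every divisibility alternative is contradictory.\<close>

lemma extreme_points_subset:
  fixes P Q :: "'a::euclidean_space set" and r :: real
  assumes dim: "DIM('a) \<ge> 2" and r: "r > 0"
    and P: "convex_polytope P" and Q: "convex_polytope Q"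
    and PB: "P \<subseteq> ball 0 r" and QB: "Q \<subseteq> ball 0 r"
    and cong: "\<And>z. z \<in> sphere 0 r \<Longrightarrow> congruent_sets (support_cone z P) (support_cone z Q)"
    and v: "v extreme_point_of P"
  shows "v extreme_point_of Q"
proof (rule ccontr)
  assume vQ: "\<not> v extreme_point_of Q"
  define VP where "VP = {x. x extreme_point_of P} - {v}"
  define VQ where "VQ = {x. x extreme_point_of Q}"
  have cP: "polytope P" "compact P" "convex P" "closed P" "interior P \<noteq> {}" "P \<noteq> {}"
    using P by (auto simp: convex_polytope_def polytope_imp_compact polytope_imp_convex
        polytope_imp_closed)
  have cQ: "polytope Q" "compact Q" "convex Q" "closed Q" "Q \<noteq> {}"
    using Q by (auto simp: convex_polytope_def polytope_imp_compact polytope_imp_convex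
        polytope_imp_closed)
  have fin: "finite VP" "finite VQ"
    using cP(1) cQ(1)
    by (auto simp: VP_def VQ_def finite_polyhedron_extreme_points polytope_imp_polyhedron)
  have vP: "v \<in> P" using v by (simp add: extreme_point_of_def)
  then have nv: "norm v < r" using PB by auto
  have nw: "norm w < r" "w \<noteq> v" if "w \<in> VQ" for w
    using that QB vQ by (auto simp: VQ_def extreme_point_of_def)
  have notin: "z \<notin> P" "z \<notin> Q" if "norm z = r" for z
    using that PB QB by auto
  obtain z0 W where z0: "norm z0 = r" "open W" "z0 \<in> W" "\<And>z. z \<in> W \<Longrightarrow> exposed_ray z P v"
    using vertex_exposed_ray_near[OF cP(1) v nv dim] by blast
  define c where "c x y = x \<bullet> y + r\<^sup>2" for x y :: 'a
  \<comment> \<open>Coefficients of all affine functions L(w) and A(v,w) that might share a root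
    with L(v), collected before the circle is chosen.\<close>
  define G where "G = (\<lambda>w. (c w w, - 2 *\<^sub>R w)) ` VQ \<union> (\<lambda>w. (c v w, - (v + w))) ` VP"
  have "finite G" using fin by (simp add: G_def)
  have pos: "0 < c v v + (- 2 *\<^sub>R v) \<bullet> z" if "norm z = r" for z
  proof -
    have "v \<noteq> z" using that nv by auto
    then show ?thesis
      using sq_dist_on_sphere[OF that, of v] unfolding c_def by (metis inner_gt_zero_iff right_minus_eq)
  qed
  obtain e where e: "norm e = r" "z0 \<bullet> e = 0"
    and gen: "\<And>\<alpha> \<beta> \<tau>. (\<alpha>, \<beta>) \<in> G \<Longrightarrow> poly (circle_poly z0 e (c v v) (- 2 *\<^sub>R v)) \<tau> = 0 \<Longrightarrow>
       Im \<tau> \<noteq> 0 \<Longrightarrow> poly (circle_poly z0 e \<alpha> \<beta>) \<tau> = 0 \<Longrightarrow> \<exists>l. \<alpha> = l * c v v \<and> \<beta> = l *\<^sub>R (- 2 *\<^sub>R v)"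
    using generic_great_circle[OF \<open>finite G\<close> z0(1) r dim pos] by metis
  define Z where "Z = circle_point z0 e"
  have nZ: "norm (Z t) = r" for t
    unfolding Z_def by (rule norm_circle_point[OF z0(1) e])
  obtain \<epsilon> where \<epsilon>: "\<epsilon> > 0" "\<And>t. 0 < t \<Longrightarrow> t < \<epsilon> \<Longrightarrow> Z t \<in> W"
  proof -
    have "continuous_on UNIV Z"
      unfolding Z_def circle_point_def
      using one_plus_square_pos by (intro continuous_intros) (metis less_irrefl)
    then have "open (Z -` W)" using z0(2) by (simp add: open_vimage)
    moreover have "0 \<in> Z -` W" using z0(3) by (simp add: Z_def circle_point_def)
    ultimately obtain d where "d > 0" "ball 0 d \<subseteq> Z -` W"
      using open_contains_ball by blast
    then show thesis by (intro that[of d]) (auto simp: subset_iff)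
  qed
  let ?Lp = "\<lambda>x. circle_poly z0 e (c x x) (- 2 *\<^sub>R x)"
  let ?Ap = "\<lambda>x y. circle_poly z0 e (c x y) (- (x + y))"
  \<comment> \<open>Equality of squared cosines of the angles at \<open>Z t\<close>, with
    denominators cleared; squaring removes the norms' square roots.\<close>
  define R where "R t = (\<lambda>(v2, w1, w2). ((v - Z t) \<bullet> (v2 - Z t))\<^sup>2 * ((w1 - Z t) \<bullet> (w1 - Z t)) * ((w2 - Z t) \<bullet> (w2 - Z t))
      = ((w1 - Z t) \<bullet> (w2 - Z t))\<^sup>2 * ((v - Z t) \<bullet> (v - Z t)) * ((v2 - Z t) \<bullet> (v2 - Z t)))" for t
  have "\<exists>b\<in>VP \<times> VQ \<times> VQ. R t b" if t: "t \<in> {0<..<\<epsilon>}" for t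
  proof -
    define z where "z = Z t"
    have z: "norm z = r" "z \<in> W" using nZ \<epsilon> t by (auto simp: z_def)
    have ev: "exposed_ray z P v" using z z0 by blast
    obtain x where x: "exposed_ray z P x" "\<And>s. x - z \<noteq> s *\<^sub>R (v - z)"
      using exposed_ray_obtains_other[OF cP(2,3,5) notin(1)[OF z(1)] vP dim] by blast
    obtain \<psi> where \<psi>: "orthogonal_transformation \<psi>" "\<psi> ` sight_directions z P = sight_directions z Q"
      using congruent_support_cones_directions[OF cong cP(6) cQ(5,4,3) notin(2)] z by auto
    \<comment> \<open>Transfer from \<open>P\<close> to itself by the identity replaces
      \<open>x\<close> by a vertex on the same ray.\<close>
    obtain v2 s where v2: "v2 extreme_point_of P" "s > 0" "x - z = s *\<^sub>R (v2 - z)"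
      using exposed_ray_transfer[OF x(1) notin(1) notin(1) cP(2,3) orthogonal_transformation_id, OF z(1) z(1)]
      by auto
    obtain w1 s1 where w1: "w1 extreme_point_of Q" "s1 > 0" "\<psi> (v - z) = s1 *\<^sub>R (w1 - z)"
      using exposed_ray_transfer[OF ev notin cQ(2,3) \<psi>, OF z(1) z(1)] by blast
    obtain w2 s2 where w2: "w2 extreme_point_of Q" "s2 > 0" "\<psi> (x - z) = s2 *\<^sub>R (w2 - z)"
      using exposed_ray_transfer[OF x(1) notin cQ(2,3) \<psi>, OF z(1) z(1)] by blast
    have inner: "\<psi> a \<bullet> \<psi> b = a \<bullet> b" and lin: "linear \<psi>" for a b
      using \<psi> by (auto simp: orthogonal_transformation_def)
    have "s *\<^sub>R \<psi> (v2 - z) = s2 *\<^sub>R (w2 - z)"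
      using w2(3) v2(3) linear_scale[OF lin] by simp
    then have \<psi>2: "\<psi> (v2 - z) = (s2 / s) *\<^sub>R (w2 - z)"
      using v2(2) by (metis divide_inverse_commute less_irrefl scaleR_scaleR scaleR_one left_inverse)
    define s3 where "s3 = s2 / s"
    have 1: "(v - z) \<bullet> (v2 - z) = s1 * s3 * ((w1 - z) \<bullet> (w2 - z))"
      using inner[of "v - z" "v2 - z"] w1(3) \<psi>2 by (simp add: s3_def mult_ac)
    have 2: "(v - z) \<bullet> (v - z) = s1\<^sup>2 * ((w1 - z) \<bullet> (w1 - z))"
      using inner[of "v - z" "v - z"] w1(3) by (simp add: power2_eq_square)
    have 3: "(v2 - z) \<bullet> (v2 - z) = s3\<^sup>2 * ((w2 - z) \<bullet> (w2 - z))"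
      using inner[of "v2 - z" "v2 - z"] \<psi>2 by (simp add: s3_def power2_eq_square)
    \<comment> \<open>The scale factors \<open>s1\<close> and \<open>s3\<close> occur squared on
      both sides.\<close>
    have "R t (v2, w1, w2)"
      unfolding R_def z_def[symmetric] prod.case 1 2 3 by (simp add: power_mult_distrib)
    moreover have "v2 \<in> VP" using v2 x(2) by (auto simp: VP_def)
    moreover have "w1 \<in> VQ" "w2 \<in> VQ" using w1 w2 by (auto simp: VQ_def)
    ultimately show ?thesis by blast
  qed
  moreover have "infinite {0<..<\<epsilon>}" using \<epsilon>(1) by simp
  ultimately obtain b where b: "b \<in> VP \<times> VQ \<times> VQ" "infinite {t \<in> {0<..<\<epsilon>}. R t b}"
    using pigeonhole_infinite_rel[of "{0<..<\<epsilon>}" "VP \<times> VQ \<times> VQ" R] fin by auto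
  then obtain v2 w1 w2 where v2: "v2 \<in> VP" and w: "w1 \<in> VQ" "w2 \<in> VQ"
    and inf: "infinite {t \<in> {0<..<\<epsilon>}. R t (v2, w1, w2)}"
    by auto
  define D where "D = (?Ap v v2)\<^sup>2 * ?Lp w1 * ?Lp w2 - (?Ap w1 w2)\<^sup>2 * ?Lp v * ?Lp v2"
  have "poly D (of_real t) = 0" if "R t (v2, w1, w2)" for t
  proof -
    define k where "k = (of_real (1 + t\<^sup>2) :: complex)"
    have L: "poly (?Lp x) (of_real t) = k * of_real ((x - Z t) \<bullet> (x - Z t))" for x
      by (simp only: poly_circle_poly Z_def[symmetric] sq_dist_on_sphere[OF nZ] c_def k_def of_real_mult)
    have A: "poly (?Ap x y) (of_real t) = k * of_real ((x - Z t) \<bullet> (y - Z t))" for x y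
      by (simp only: poly_circle_poly Z_def[symmetric] inner_on_sphere[OF nZ] c_def k_def of_real_mult)
    \<comment> \<open>Each product has four quadratic factors, each contributing one
      \<open>k\<close>.\<close>
    have "poly D (of_real t) = k ^ 4 * of_real (((v - Z t) \<bullet> (v2 - Z t))\<^sup>2 * ((w1 - Z t) \<bullet> (w1 - Z t)) * ((w2 - Z t) \<bullet> (w2 - Z t))
      - ((w1 - Z t) \<bullet> (w2 - Z t))\<^sup>2 * ((v - Z t) \<bullet> (v - Z t)) * ((v2 - Z t) \<bullet> (v2 - Z t)))"
      unfolding D_def poly_diff poly_mult poly_power L A of_real_diff of_real_mult of_real_power
      by (simp only: power2_eq_square power4_eq_xxxx right_diff_distrib mult_ac)
    also have "\<dots> = 0" using that by (simp add: R_def)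
    finally show ?thesis .
  qed
  then have "of_real ` {t \<in> {0<..<\<epsilon>}. R t (v2, w1, w2)} \<subseteq> {x. poly D x = 0}" by auto
  moreover have "infinite (of_real ` {t \<in> {0<..<\<epsilon>}. R t (v2, w1, w2)} :: complex set)"
    using inf by (subst finite_image_iff) (auto simp: inj_on_def)
  ultimately have "D = 0" using poly_roots_finite finite_subset by metis
  obtain \<tau> where \<tau>: "poly (?Lp v) \<tau> = 0" "Im \<tau> \<noteq> 0"
    using circle_poly_positive_root[OF z0(1) e pos] by blast
  \<comment> \<open>Evaluation at \<open>\<tau>\<close> replaces the primality argument: the
    subtracted product vanishes, so a factor of the first one does.\<close>
  have "poly D \<tau> = 0" using \<open>D = 0\<close> by simp
  then consider "poly (?Ap v v2) \<tau> = 0" | "poly (?Lp w1) \<tau> = 0" | "poly (?Lp w2) \<tau> = 0"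
    using \<tau>(1) by (auto simp: D_def)
  moreover have "poly (?Lp w) \<tau> \<noteq> 0" if "w \<in> VQ" for w
  proof
    assume "poly (?Lp w) \<tau> = 0"
    moreover have "(c w w, - 2 *\<^sub>R w) \<in> G" using that by (auto simp: G_def)
    ultimately obtain l where "c w w = l * c v v" "- 2 *\<^sub>R w = l *\<^sub>R (- 2 *\<^sub>R v)"
      using gen \<tau> by blast
    then have "w = v"
      using sq_dist_proportional[OF nv nw(1)[OF that]] by (auto simp: c_def)
    then show False using nw(2)[OF that] by simp
  qed
  moreover have "poly (?Ap v v2) \<tau> \<noteq> 0"
  proof
    assume "poly (?Ap v v2) \<tau> = 0"
    moreover have "(c v v2, - (v + v2)) \<in> G" using v2 by (auto simp: G_def)
    ultimately obtain l where "c v v2 = l * c v v" "- (v + v2) = l *\<^sub>R (- 2 *\<^sub>R v)"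
      using gen \<tau> by blast
    then have "v2 = v"
      using inner_proportional[OF nv] unfolding c_def by blast
    then show False using v2 by (simp add: VP_def)
  qed
  ultimately show False using w by blast
qed

lemma congruent_sets_sym:
  fixes A B :: "'a::euclidean_space set"
  assumes "congruent_sets A B"
  shows "congruent_sets B A"
proof -
  obtain \<phi> b where \<phi>: "orthogonal_transformation \<phi>" and im: "(\<lambda>x. \<phi> x + b) ` A = B"
    using assms unfolding congruent_sets_def by blast
  have inv: "orthogonal_transformation (inv \<phi>)"
    using \<phi> by (rule orthogonal_transformation_inv)
  then have lin: "linear (inv \<phi>)" by (rule orthogonal_transformation_linear)
  have "inv \<phi> (\<phi> x + b) + - inv \<phi> b = x" for x
    using inv_f_f[OF orthogonal_transformation_inj[OF \<phi>]] by (simp add: linear_add[OF lin])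
  then have "(\<lambda>y. inv \<phi> y + - inv \<phi> b) ` B = A"
    unfolding im[symmetric] image_image by simp
  then show ?thesis using inv unfolding congruent_sets_def by blast
qed

theorem theorem1:
  fixes P Q :: "'a::euclidean_space set" and r :: real
  assumes "DIM('a) \<ge> 3" and "r > 0"
    and "convex_polytope P" and "convex_polytope Q"
    and "P \<subseteq> interior (cball 0 r)" and "Q \<subseteq> interior (cball 0 r)"
    and "\<And>z. z \<in> sphere 0 r \<Longrightarrow> congruent_sets (support_cone z P) (support_cone z Q)"
  shows "P = Q"
proof -
  have dim: "DIM('a) \<ge> 2" using assms(1) by simp
  have B: "P \<subseteq> ball 0 r" "Q \<subseteq> ball 0 r" using assms(5,6) by (simp_all add: interior_cball)
  \<comment> \<open>The hypotheses are symmetric in \<open>P\<close> and \<open>Q\<close>, so the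
    inclusion applies both ways.\<close>
  have "{x. x extreme_point_of P} = {x. x extreme_point_of Q}"
    using extreme_points_subset[OF dim assms(2,3,4) B assms(7)]
      extreme_points_subset[OF dim assms(2,4,3) B(2,1) congruent_sets_sym[OF assms(7)]]
    by blast
  moreover have "P = convex hull {x. x extreme_point_of P}" "Q = convex hull {x. x extreme_point_of Q}"
    using assms(3,4) Krein_Milman_Minkowski polytope_imp_compact polytope_imp_convex
    unfolding convex_polytope_def by blast+
  ultimately show ?thesis by metis
qed

end
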